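(* Let $p\ge 3$ be a prime and $n\geq 1$ an integer. Let $A=A_{Pow^{\ast}(\mathbb{Z}_{p^{n}})}$ be the adjacency matrix of the punctured power digraph of the cyclic group of order $p^n$, and let $I$ be the identity matrix of size $p^n-1$. For $1\le k\le p^n-1$, the greatest common divisor of the determinants of the $(k\times k)$-submatrices of $I-A^{tr}$ is equal to $$\begin{cases} 1, & \text{for } 1\leq k\leq n,\\ 2^{k-n}, & \text{for } n+1\leq k\leq p^n-n-1,\\ 2^{2k-p^n+1}, & \text{for } p^n-n\leq k\leq p^n-2,\\ \left|\prod_{i=1}^{n}\big(2-\varphi(p^i)\big)2^{\varphi(p^i)-1}\right|, & \text{for } k=p^n-1,\end{cases}$$ where $\varphi$ is Euler's totient function.
   Context: The punctured power digraph $Pow^{\ast}(G)$ of a group $G$ has the non-identity elements of $G$ as vertices, with exactly one directed edge from $x$ to $y$ whenever $x\ne y$ and $y=x^m$ for some integer $m$ (and no other edges). The adjacency matrix of a finite digraph is the square integer matrix indexed by the vertices whose $(u,v)$-entry is the number of edges from $u$ to $v$. A $(k\times k)$-submatrix is obtained by choosing $k$ distinct rows and $k$ distinct columns and taking their intersection. The greatest common divisor is taken to be non-negative (and is $0$ if all the determinants vanish). Explicitly, after ordering the vertices by the order of the corresponding group elements, $I-A^{tr}$ is the block upper triangular matrix with diagonal blocks $B_{p-1},B_{p^2-p},\dots,B_{p^n-p^{n-1}}$, all entries above the diagonal blocks equal to $-1$, and all entries below the diagonal blocks equal to $0$, where $B_k$ is the $k\times k$ matrix with $1$ on the diagonal and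 $-1$ elsewhere. *)

theory Defs
  imports
    "HOL-Algebra.Elementary_Groups"
    "HOL-Number_Theory.Totient"
    "Graph_Theory.Pair_Digraph"
    "Jordan_Normal_Form.Determinant"
    "Jordan_Normal_Form.DL_Submatrix"
begin

definition punctured_power_digraph :: "('a, 'b) monoid_scheme \<Rightarrow> 'a pair_pre_digraph" where
  "punctured_power_digraph G =
     \<lparr> pverts = carrier G - {\<one>\<^bsub>G\<^esub>},
       parcs = {(x, y). x \<in> carrier G - {\<one>\<^bsub>G\<^esub>} \<and> y \<in> carrier G - {\<one>\<^bsub>G\<^esub>} \<and> x \<noteq> y \<and>
                        (\<exists>m::int. y = x [^]\<^bsub>G\<^esub> m)} \<rparr>"

lemma digraph_punctured_power_digraph:
  assumes "finite (carrier G)"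
  shows "digraph (with_proj (punctured_power_digraph G))"
proof -
  have "finite (parcs (punctured_power_digraph G))"
    by (rule finite_subset[of _ "carrier G \<times> carrier G"])
       (use assms in \<open>auto simp: punctured_power_digraph_def\<close>)
  then show ?thesis
    using assms
    by unfold_locales (auto simp: punctured_power_digraph_def arc_to_ends_def)
qed

text \<open>
  The vertices are ordered by a list \<open>vs\<close>, which is meant to enumerate the vertex set
  without repetition.
\<close>
definition adjacency_mat :: "('a, 'b) pre_digraph \<Rightarrow> 'a list \<Rightarrow> int mat" where
  "adjacency_mat D vs = mat (length vs) (length vs)
     (\<lambda>(i, j). int (card {e \<in> arcs D. tail D e = vs ! i \<and> head D e = vs ! j}))"

text \<open>
  The selected rows and columns are kept in increasing order of their indices; any other
  order changes a determinant only by a sign.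
\<close>
definition minors :: "'a::comm_ring_1 mat \<Rightarrow> nat \<Rightarrow> 'a set" where
  "minors M k = {det (submatrix M R C) | R C.
     R \<subseteq> {..<dim_row M} \<and> C \<subseteq> {..<dim_col M} \<and> card R = k \<and> card C = k}"

end

theory Submission
  imports Defs "HOL-Library.Function_Algebras"
begin

text \<open>
  The \<open>k\<close>-th determinantal divisor of an integer matrix does not change under unimodular row
  and column operations, so it suffices to bring \<open>M = I - A\<^sup>T\<close> to diagonal form. Here this is
  phrased with a bilinear form: if \<open>M\<close> is the Gram matrix of \<open>\<beta>\<close> on the standard basis and
  \<open>r\<close>, \<open>c\<close> are two families generating the same module such that \<open>\<beta> (r a) (c b)\<close> vanishes for
  \<open>a \<noteq> b\<close>, then the common divisors of the \<open>k\<close>-minors of \<open>M\<close> are the common divisors of the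
  products of \<open>k\<close> of the values \<open>\<beta> (r a) (c a)\<close> (lemma \<open>common_divisors_minors_diagonal\<close>).
  The reason is that a determinant is linear in every row and column, so each determinant
  built from one family is an integer combination of those built from the other.

  In a cyclic group of order \<open>p ^ n\<close>, \<open>x\<close> is a multiple of \<open>y\<close> iff \<open>y\<close> is divisible by at most
  as high a power of \<open>p\<close> as \<open>x\<close>. With the level \<open>l\<close>, where elements of order \<open>p ^ (i + 1)\<close> have
  level \<open>i\<close>, the matrix is \<open>M a b = 2 [a = b] - [l a \<le> l b]\<close>, and the fibre of level \<open>i\<close> has
  \<open>\<phi>(p ^ (i + 1)) = 2 q\<^sub>i\<close> elements, an even positive number.

  Choose two elements \<open>v i \<noteq> w i\<close> of level \<open>i\<close>, and write \<open>F i\<close> for the sum of the basis vectors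
  \<open>e a\<close> of level \<open>i\<close>. For \<open>a\<close>, \<open>b\<close> other than these representatives, \<open>e a - e (w (l a))\<close> and
  \<open>e b - e (v (l b))\<close> pair to \<open>2 [a = b]\<close>, because the second summand of \<open>M\<close> depends on levels
  only; this splits off the value \<open>2\<close> for \<open>N - 2 n\<close> elements. The triangular matrix of ones
  \<open>[i \<le> j]\<close> is unimodular; pairing \<open>e (w i) - e (w (i + 1))\<close> with \<open>e (v j)\<close> inverts it and gives
  the value \<open>-1\<close> for each level. What remains, after clearing, is the bidiagonal matrix with
  \<open>4 (1 - q\<^sub>i)\<close> on the diagonal and \<open>-4\<close> next to it. Telescoping combinations of its rows and
  columns turn it into \<open>n - 1\<close> values \<open>-4\<close> and a single value
  \<open>4 (1 - q\<^sub>0) \<cdots> (1 - q\<^sub>n\<^sub>-\<^sub>1)\<close>.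

  Hence the diagonal entries are, up to sign, \<open>n\<close> ones, \<open>N - 2 n\<close> twos, \<open>n - 1\<close> fours and one multiple of
  four, and for \<open>k < N\<close> the divisor is \<open>2\<close> to the power \<open>(k - n) + (k - (N - n))\<close> with truncated
  subtractions (lemma \<open>Gcd_minors_entry\<close>). This one formula covers the first three ranges of \<open>k\<close>; for
  \<open>k = N\<close> the divisor is the product of all the entries.
\<close>

section \<open>Determinants as multilinear functions\<close>

definition table_det :: "nat \<Rightarrow> (nat \<Rightarrow> nat \<Rightarrow> 'a::comm_ring_1) \<Rightarrow> 'a" where
  "table_det k h = det (mat k k (\<lambda>(i, j). h i j))"

lemma table_det_cong:
  assumes "\<And>i j. i < k \<Longrightarrow> j < k \<Longrightarrow> h i j = h' i j"
  shows "table_det k h = table_det k h'"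
  unfolding table_det_def using assms by (intro arg_cong[of _ _ det] eq_matI) auto

lemma table_det_transpose: "table_det k (\<lambda>i j. h j i) = table_det k h"
proof -
  have "transpose_mat (mat k k (\<lambda>(i, j). h i j)) = mat k k (\<lambda>(i, j). h j i)"
    by (intro eq_matI) auto
  then show ?thesis
    unfolding table_det_def using det_transpose[of "mat k k (\<lambda>(i, j). h i j)" k] by simp
qed

lemma table_det_leibniz:
  "table_det k h = (\<Sum>q | q permutes {0..<k}. signof q * (\<Prod>i = 0..<k. h i (q i)))"
  unfolding table_det_def
  by (subst det_def'[of _ k])
     (auto intro!: sum.cong arg_cong2[of _ _ _ _ "(*)"] prod.cong simp: permutes_in_image)

text \<open>
  Laplace expansion along row \<open>m\<close>; what matters is that the coefficients do not depend on that
  row, so the determinant is a linear function of it.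
\<close>
lemma table_det_row_expansion:
  assumes "m < k"
  obtains c where "\<And>\<rho>. table_det k (\<lambda>i j. if i = m then \<rho> j else h i j) = (\<Sum>j<k. \<rho> j * c j)"
proof -
  define A where "A \<rho> = mat k k (\<lambda>(i, j). if i = m then \<rho> j else h i j)" for \<rho> :: "nat \<Rightarrow> 'a"
  have cof: "cofactor (A \<rho>) m j = cofactor (A (\<lambda>_. 0)) m j" for \<rho> j
  proof -
    have "mat_delete (A \<rho>) m j = mat_delete (A (\<lambda>_. 0)) m j"
      using assms by (intro eq_matI) (auto simp: mat_delete_def A_def)
    then show ?thesis by (simp add: cofactor_def)
  qed
  have "table_det k (\<lambda>i j. if i = m then \<rho> j else h i j)
      = (\<Sum>j<k. \<rho> j * cofactor (A (\<lambda>_. 0)) m j)" for \<rho>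
  proof -
    have "table_det k (\<lambda>i j. if i = m then \<rho> j else h i j) = det (A \<rho>)"
      by (simp add: table_det_def A_def)
    also have "\<dots> = (\<Sum>j<k. A \<rho> $$ (m, j) * cofactor (A \<rho>) m j)"
      using assms by (intro laplace_expansion_row) (auto simp: A_def)
    also have "\<dots> = (\<Sum>j<k. \<rho> j * cofactor (A (\<lambda>_. 0)) m j)"
      using assms by (intro sum.cong refl) (subst cof, simp add: A_def)
    finally show ?thesis .
  qed
  then show thesis by (rule that)
qed

lemma table_det_equal_rows:
  assumes "i < k" "i' < k" "i \<noteq> i'" "\<And>j. j < k \<Longrightarrow> h i j = h i' j"
  shows "table_det k h = 0"
  unfolding table_det_def
  using assms by (intro det_identical_rows[of _ k i i'] eq_vecI) auto

text \<open>
  By linearity in one row, the vectors that may be put there while keeping divisibility by \<open>d\<close>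
  form a submodule, hence contain the span of \<open>S\<close> once they contain \<open>S\<close>. The rows are released
  from \<open>S\<close> to \<open>span S\<close> one after the other. This replaces expanding a determinant of linear
  combinations (the Cauchy--Binet formula).
\<close>
lemma (in Modules.module) dvd_table_det_span_rows:
  assumes add: "\<And>j x y. \<phi> j (x + y) = \<phi> j x + \<phi> j y"
    and scale_hom: "\<And>j c x. \<phi> j (c *s x) = c * \<phi> j x"
    and dvd: "\<And>x. (\<And>i. i < k \<Longrightarrow> x i \<in> S) \<Longrightarrow> d dvd table_det k (\<lambda>i j. \<phi> j (x i))"
    and x: "\<And>i. i < k \<Longrightarrow> x i \<in> span S"
  shows "d dvd table_det k (\<lambda>i j. \<phi> j (x i))"
proof -
  \<comment> \<open>The first \<open>m\<close> rows are already allowed to range over the span.\<close>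
  have "d dvd table_det k (\<lambda>i j. \<phi> j (x i))"
    if "m \<le> k" "\<And>i. i < m \<Longrightarrow> x i \<in> span S" "\<And>i. m \<le> i \<Longrightarrow> i < k \<Longrightarrow> x i \<in> S" for m x
    using that
  proof (induction m arbitrary: x)
    case 0
    then show ?case by (intro dvd) auto
  next
    case (Suc m)
    then have "m < k" by simp
    then obtain c where c: "\<And>\<rho>. table_det k (\<lambda>i j. if i = m then \<rho> j else \<phi> j (x i))
        = (\<Sum>j<k. \<rho> j * c j)"
      using table_det_row_expansion[of m k "\<lambda>i j. \<phi> j (x i)"] by blast
    define D where "D y = table_det k (\<lambda>i j. \<phi> j ((x(m := y)) i))" for y
    have D: "D y = (\<Sum>j<k. \<phi> j y * c j)" for y
      unfolding D_def c[symmetric] by (intro table_det_cong) auto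
    have zero: "\<phi> j 0 = 0" for j
      using scale_hom[of j 0 0] by simp
    have "subspace {y. d dvd D y}"
      unfolding subspace_def
      by (auto simp: D zero add scale_hom distrib_right sum.distrib mult.assoc
               simp flip: sum_distrib_left)
    moreover have "S \<subseteq> {y. d dvd D y}"
      using Suc by (auto simp: D_def intro!: Suc.IH)
    ultimately have "span S \<subseteq> {y. d dvd D y}"
      by (intro span_minimal)
    then have "d dvd D (x m)"
      using Suc.prems(2)[of m] by auto
    then show ?case by (simp add: D_def)
  qed
  from this[of k] show ?thesis using x by simp
qed

lemma (in Modules.module) dvd_table_det_span:
  assumes add_left: "\<And>x x' y. \<beta> (x + x') y = \<beta> x y + \<beta> x' y"
    and scale_left: "\<And>c x y. \<beta> (c *s x) y = c * \<beta> x y"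
    and add_right: "\<And>x y y'. \<beta> x (y + y') = \<beta> x y + \<beta> x y'"
    and scale_right: "\<And>c x y. \<beta> x (c *s y) = c * \<beta> x y"
    and dvd: "\<And>x y. (\<And>i. i < k \<Longrightarrow> x i \<in> S) \<Longrightarrow> (\<And>j. j < k \<Longrightarrow> y j \<in> T) \<Longrightarrow>
                d dvd table_det k (\<lambda>i j. \<beta> (x i) (y j))"
    and x: "\<And>i. i < k \<Longrightarrow> x i \<in> span S" and y: "\<And>j. j < k \<Longrightarrow> y j \<in> span T"
  shows "d dvd table_det k (\<lambda>i j. \<beta> (x i) (y j))"
proof (rule dvd_table_det_span_rows[where \<phi> = "\<lambda>j x. \<beta> x (y j)" and S = S])
  fix x' assume x': "\<And>i. i < k \<Longrightarrow> x' i \<in> S"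
  have "d dvd table_det k (\<lambda>j i. \<beta> (x' i) (y j))"
  proof (rule dvd_table_det_span_rows[where \<phi> = "\<lambda>i y. \<beta> (x' i) y" and S = T])
    fix y' assume "\<And>j. j < k \<Longrightarrow> y' j \<in> T"
    then have "d dvd table_det k (\<lambda>i j. \<beta> (x' i) (y' j))"
      using x' by (intro dvd) auto
    then show "d dvd table_det k (\<lambda>j i. \<beta> (x' i) (y' j))"
      by (subst table_det_transpose)
  qed (use add_right scale_right y in auto)
  then show "d dvd table_det k (\<lambda>i j. \<beta> (x' i) (y j))"
    by (subst table_det_transpose[symmetric])
qed (use add_left scale_left x in auto)

section \<open>Minors and arbitrary selections of rows and columns\<close>

lemma bij_betw_pick:
  assumes "finite R"
  shows "bij_betw (pick R) {0..<card R} R"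
proof (rule bij_betwI[where g = "\<lambda>a. card {b \<in> R. b < a}"])
  show "pick R \<in> {0..<card R} \<rightarrow> R"
    by (auto intro: pick_in_set_le)
  show "(\<lambda>a. card {b \<in> R. b < a}) \<in> R \<rightarrow> {0..<card R}"
    using assms by (auto intro!: psubset_card_mono)
  show "card {b \<in> R. b < pick R i} = i" if "i \<in> {0..<card R}" for i
    using that by (intro card_pick_le) auto
  show "pick R (card {b \<in> R. b < a}) = a" if "a \<in> R" for a
    using that by (rule pick_card_in_set)
qed

text \<open>
  A determinant whose rows are selected with a repetition vanishes, and otherwise reordering the
  selected rows increasingly changes only the sign. So divisibility may be tested on increasing
  selections.
\<close>
lemma dvd_table_det_reindex_rows:
  assumes dvd: "\<And>R. R \<subseteq> {..<N} \<Longrightarrow> card R = k \<Longrightarrow> d dvd table_det k (\<lambda>i j. h (pick R i) j)"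
    and f: "\<And>i. i < k \<Longrightarrow> f i < N"
  shows "d dvd table_det k (\<lambda>i j. h (f i) j)"
proof (cases "inj_on f {0..<k}")
  case False
  then obtain i i' where "i < k" "i' < k" "i \<noteq> i'" "f i = f i'"
    by (auto simp: inj_on_def)
  then have "table_det k (\<lambda>i j. h (f i) j) = 0"
    by (intro table_det_equal_rows[of i _ i']) auto
  then show ?thesis by simp
next
  case True
  define R where "R = f ` {0..<k}"
  have R: "R \<subseteq> {..<N}" "card R = k" "finite R"
    using f True by (auto simp: R_def card_image)
  have pick: "bij_betw (pick R) {0..<k} R"
    using bij_betw_pick[of R] R by simp
  define \<sigma> where "\<sigma> i = (if i < k then inv_into {0..<k} (pick R) (f i) else i)" for i
  have "bij_betw (inv_into {0..<k} (pick R) \<circ> f) {0..<k} {0..<k}"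
    using True pick by (intro bij_betw_trans[of f _ R] bij_betw_inv_into) (auto simp: bij_betw_def R_def)
  then have "bij_betw \<sigma> {0..<k} {0..<k}"
    by (rule bij_betw_cong[THEN iffD1, rotated]) (auto simp: \<sigma>_def)
  then have \<sigma>: "\<sigma> permutes {0..<k}"
    by (rule bij_imp_permutes) (auto simp: \<sigma>_def)
  have f_eq: "f i = pick R (\<sigma> i)" if "i < k" for i
    using that pick by (simp add: \<sigma>_def R_def bij_betw_def f_inv_into_f)
  define A where "A = mat k k (\<lambda>(i, j). h (pick R i) j)"
  have "table_det k (\<lambda>i j. h (f i) j) = det (mat k k (\<lambda>(i, j). A $$ (\<sigma> i, j)))"
    unfolding table_det_def A_def using \<sigma>
    by (intro arg_cong[of _ _ det] eq_matI) (auto simp: f_eq dest: permutes_in_image)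
  also have "\<dots> = signof \<sigma> * det A"
    using \<sigma> by (intro det_permute_rows) (auto simp: A_def)
  finally show ?thesis
    using dvd[OF R(1,2)] by (simp add: A_def table_det_def)
qed

lemma minors_eq:
  "minors M k = {table_det k (\<lambda>i j. M $$ (pick R i, pick C j)) | R C.
     R \<subseteq> {..<dim_row M} \<and> C \<subseteq> {..<dim_col M} \<and> card R = k \<and> card C = k}"
proof -
  have "det (submatrix M R C) = table_det k (\<lambda>i j. M $$ (pick R i, pick C j))"
    if "R \<subseteq> {..<dim_row M}" "C \<subseteq> {..<dim_col M}" "card R = k" "card C = k" for R C
  proof -
    have "{i. i < dim_row M \<and> i \<in> R} = R" "{j. j < dim_col M \<and> j \<in> C} = C"
      using that by auto
    then show ?thesis
      using that by (simp add: submatrix_def table_det_def)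
  qed
  then show ?thesis
    unfolding minors_def by (intro Collect_cong) metis
qed

lemma dvd_table_det_if_dvd_minors:
  assumes dvd: "\<And>m. m \<in> minors M k \<Longrightarrow> d dvd m"
    and f: "\<And>i. i < k \<Longrightarrow> f i < dim_row M" and g: "\<And>j. j < k \<Longrightarrow> g j < dim_col M"
  shows "d dvd table_det k (\<lambda>i j. M $$ (f i, g j))"
proof (rule dvd_table_det_reindex_rows[OF _ f])
  fix R assume R: "R \<subseteq> {..<dim_row M}" "card R = k"
  have "d dvd table_det k (\<lambda>j i. M $$ (pick R i, g j))"
  proof (rule dvd_table_det_reindex_rows[OF _ g])
    fix C assume "C \<subseteq> {..<dim_col M}" "card C = k"
    then have "d dvd table_det k (\<lambda>i j. M $$ (pick R i, pick C j))"
      using R by (intro dvd) (auto simp: minors_eq)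
    then show "d dvd table_det k (\<lambda>j i. M $$ (pick R i, pick C j))"
      by (subst table_det_transpose)
  qed
  then show "d dvd table_det k (\<lambda>i j. M $$ (pick R i, g j))"
    by (subst table_det_transpose[symmetric])
qed

section \<open>Determinantal divisors from a diagonal Gram matrix\<close>

lemma table_det_diagonal:
  assumes f: "bij_betw f {0..<k} S"
  shows "table_det k (\<lambda>i j. if f i = f j then \<delta> (f i) else 0) = (\<Prod>a\<in>S. \<delta> a)"
proof -
  have "table_det k (\<lambda>i j. if f i = f j then \<delta> (f i) else 0)
      = table_det k (\<lambda>i j. if i = j then \<delta> (f i) else 0)"
    using f by (intro table_det_cong) (auto simp: bij_betw_def inj_on_eq_iff)
  also have "\<dots> = prod_list (diag_mat (mat k k (\<lambda>(i, j). if i = j then \<delta> (f i) else 0)))"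
    unfolding table_det_def by (intro det_upper_triangular) auto
  also have "\<dots> = (\<Prod>i = 0..<k. \<delta> (f i))"
    by (simp add: diag_mat_def flip: prod.distinct_set_conv_list)
  also have "\<dots> = (\<Prod>a\<in>S. \<delta> a)"
    by (rule prod.reindex_bij_betw[OF f])
  finally show ?thesis .
qed

text \<open>
  In the Leibniz formula a term is either zero or the product of the \<open>\<delta> (f i)\<close>, which for
  injective \<open>f\<close> is a product over a set of \<open>k\<close> indices.
\<close>
lemma dvd_table_det_diagonal:
  assumes dvd: "\<And>S. S \<subseteq> I \<Longrightarrow> card S = k \<Longrightarrow> d dvd (\<Prod>a\<in>S. \<delta> a)"
    and f: "\<And>i. i < k \<Longrightarrow> f i \<in> I"
  shows "d dvd table_det k (\<lambda>i j. if f i = g j then \<delta> (f i) else 0)"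
proof (cases "inj_on f {0..<k}")
  case False
  then obtain i i' where "i < k" "i' < k" "i \<noteq> i'" "f i = f i'"
    by (auto simp: inj_on_def)
  then have "table_det k (\<lambda>i j. if f i = g j then \<delta> (f i) else 0) = 0"
    by (intro table_det_equal_rows[of i _ i']) auto
  then show ?thesis by simp
next
  case True
  have "d dvd (\<Prod>a\<in>f ` {0..<k}. \<delta> a)"
    using True f by (intro dvd) (auto simp: card_image)
  then have d: "d dvd (\<Prod>i = 0..<k. \<delta> (f i))"
    using True by (simp add: prod.reindex)
  show ?thesis
    unfolding table_det_leibniz
  proof (rule dvd_sum, rule dvd_mult)
    fix q
    show "d dvd (\<Prod>i = 0..<k. if f i = g (q i) then \<delta> (f i) else 0)"
    proof (cases "\<forall>i<k. f i = g (q i)")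
      case True
      then show ?thesis using d by simp
    next
      case False
      then have "(\<Prod>i = 0..<k. if f i = g (q i) then \<delta> (f i) else 0) = 0"
        by (intro prod_zero) auto
      then show ?thesis by simp
    qed
  qed
qed

text \<open>
  The invariance of determinantal divisors, in the form needed for explicit bases: \<open>r\<close> and \<open>c\<close>
  generate the same submodule as \<open>e\<close>, so the determinants of \<open>\<beta>\<close> built from \<open>e\<close> and those
  built from \<open>r\<close> and \<open>c\<close> have the same common divisors.
\<close>
lemma (in Modules.module) common_divisors_minors_diagonal:
  fixes \<beta> :: "'b \<Rightarrow> 'b \<Rightarrow> 'a" and e :: "nat \<Rightarrow> 'b" and r c :: "'i \<Rightarrow> 'b"
  assumes add_left: "\<And>x x' y. \<beta> (x + x') y = \<beta> x y + \<beta> x' y"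
    and scale_left: "\<And>c x y. \<beta> (c *s x) y = c * \<beta> x y"
    and add_right: "\<And>x y y'. \<beta> x (y + y') = \<beta> x y + \<beta> x y'"
    and scale_right: "\<And>c x y. \<beta> x (c *s y) = c * \<beta> x y"
    and M: "M \<in> carrier_mat N N" "\<And>i j. i < N \<Longrightarrow> j < N \<Longrightarrow> M $$ (i, j) = \<beta> (e i) (e j)"
    and r: "\<And>a. a \<in> I \<Longrightarrow> r a \<in> span (e ` {..<N})" "\<And>i. i < N \<Longrightarrow> e i \<in> span (r ` I)"
    and c: "\<And>a. a \<in> I \<Longrightarrow> c a \<in> span (e ` {..<N})" "\<And>i. i < N \<Longrightarrow> e i \<in> span (c ` I)"
    and diag: "\<And>a b. a \<in> I \<Longrightarrow> b \<in> I \<Longrightarrow> \<beta> (r a) (c b) = (if a = b then \<delta> a else 0)"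
    and "finite I"
  shows "(\<forall>m \<in> minors M k. d dvd m) \<longleftrightarrow> (\<forall>S. S \<subseteq> I \<and> card S = k \<longrightarrow> d dvd (\<Prod>a\<in>S. \<delta> a))"
proof (intro iffI allI impI ballI; (elim conjE)?)
  fix S assume minors: "\<forall>m \<in> minors M k. d dvd m" and S: "S \<subseteq> I" "card S = k"
  then have "finite S" using \<open>finite I\<close> finite_subset by blast
  then obtain f where f: "bij_betw f {0..<k} S"
    using ex_bij_betw_nat_finite[of S] S by blast
  then have fI: "f i \<in> I" if "i < k" for i
    using that S by (auto simp: bij_betw_def)
  have "d dvd table_det k (\<lambda>i j. \<beta> (r (f i)) (c (f j)))"
  proof (rule dvd_table_det_span[where S = "e ` {..<N}" and T = "e ` {..<N}", OF add_left scale_left add_right scale_right])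
    fix x y assume "\<And>i. i < k \<Longrightarrow> x i \<in> e ` {..<N}" "\<And>j. j < k \<Longrightarrow> y j \<in> e ` {..<N}"
    then have "\<forall>i\<in>{..<k}. \<exists>t. t < N \<and> x i = e t" "\<forall>j\<in>{..<k}. \<exists>t. t < N \<and> y j = e t"
      by (auto simp: image_iff)
    from this[THEN bchoice] obtain g h where gh: "\<And>i. i < k \<Longrightarrow> g i < N \<and> x i = e (g i)"
        "\<And>j. j < k \<Longrightarrow> h j < N \<and> y j = e (h j)"
      by auto
    have "table_det k (\<lambda>i j. \<beta> (x i) (y j)) = table_det k (\<lambda>i j. M $$ (g i, h j))"
      using gh M by (intro table_det_cong) auto
    moreover have "d dvd table_det k (\<lambda>i j. M $$ (g i, h j))"
      using minors gh M by (intro dvd_table_det_if_dvd_minors) auto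
    ultimately show "d dvd table_det k (\<lambda>i j. \<beta> (x i) (y j))" by simp
  qed (use fI r c in auto)
  moreover have "table_det k (\<lambda>i j. \<beta> (r (f i)) (c (f j)))
      = table_det k (\<lambda>i j. if f i = f j then \<delta> (f i) else 0)"
    using fI by (intro table_det_cong) (auto simp: diag)
  ultimately show "d dvd (\<Prod>a\<in>S. \<delta> a)"
    using table_det_diagonal[OF f, of \<delta>] by simp
next
  fix m assume prods: "\<forall>S. S \<subseteq> I \<and> card S = k \<longrightarrow> d dvd (\<Prod>a\<in>S. \<delta> a)" and "m \<in> minors M k"
  then obtain R C where m: "m = table_det k (\<lambda>i j. M $$ (pick R i, pick C j))"
      and RC: "R \<subseteq> {..<N}" "C \<subseteq> {..<N}" "card R = k" "card C = k"
    using M(1) by (auto simp: minors_eq)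
  have pick: "pick R i < N" "pick C i < N" if "i < k" for i
    using that RC pick_in_set_le[of i R] pick_in_set_le[of i C] by auto
  have "d dvd table_det k (\<lambda>i j. \<beta> (e (pick R i)) (e (pick C j)))"
  proof (rule dvd_table_det_span[where S = "r ` I" and T = "c ` I", OF add_left scale_left add_right scale_right])
    fix x y assume "\<And>i. i < k \<Longrightarrow> x i \<in> r ` I" "\<And>j. j < k \<Longrightarrow> y j \<in> c ` I"
    then have "\<forall>i\<in>{..<k}. \<exists>t. t \<in> I \<and> x i = r t" "\<forall>j\<in>{..<k}. \<exists>t. t \<in> I \<and> y j = c t"
      by (auto simp: image_iff)
    from this[THEN bchoice] obtain g h where gh: "\<And>i. i < k \<Longrightarrow> g i \<in> I \<and> x i = r (g i)"
        "\<And>j. j < k \<Longrightarrow> h j \<in> I \<and> y j = c (h j)"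
      by auto
    have "table_det k (\<lambda>i j. \<beta> (x i) (y j)) = table_det k (\<lambda>i j. if g i = h j then \<delta> (g i) else 0)"
      using gh by (intro table_det_cong) (auto simp: diag)
    moreover have "d dvd table_det k (\<lambda>i j. if g i = h j then \<delta> (g i) else 0)"
      using prods gh by (intro dvd_table_det_diagonal) auto
    ultimately show "d dvd table_det k (\<lambda>i j. \<beta> (x i) (y j))" by simp
  qed (use pick r c in auto)
  moreover have "m = table_det k (\<lambda>i j. \<beta> (e (pick R i)) (e (pick C j)))"
    unfolding m using pick M(2) by (intro table_det_cong) auto
  ultimately show "d dvd m" by simp
qed

section \<open>Matrices determined by a level function\<close>

definition coord_scale :: "int \<Rightarrow> (nat \<Rightarrow> int) \<Rightarrow> nat \<Rightarrow> int" where
  "coord_scale c f = (\<lambda>x. c * f x)"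

interpretation coord: Modules.module coord_scale
  by unfold_locales (auto simp: coord_scale_def fun_eq_iff algebra_simps)

definition unit :: "nat \<Rightarrow> nat \<Rightarrow> int" where
  "unit a = (\<lambda>x. of_bool (x = a))"

text \<open>
  Index type of the two diagonalising families: one \<open>Link\<close> per level (value \<open>-1\<close>), one \<open>Twin\<close>
  per element outside the chosen representatives (value \<open>2\<close>), one \<open>Chain\<close> per level (value
  divisible by \<open>4\<close>).
\<close>
datatype slot = Link nat | Twin nat | Chain nat

text \<open>
  Each level keeps two points \<open>v i\<close> and \<open>w i\<close> apart: rows are compared with \<open>w\<close> and columns
  with \<open>v\<close>, so that the differences of the remaining points stay orthogonal to both. Evenness of
  the fibres lets a factor \<open>4\<close>, and not only \<open>2\<close>, split off from the last block.
\<close>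
locale levels =
  fixes N n :: nat and l v w :: "nat \<Rightarrow> nat" and q :: "nat \<Rightarrow> int"
  assumes level_less: "a < N \<Longrightarrow> l a < n"
    and v: "i < n \<Longrightarrow> v i < N" "i < n \<Longrightarrow> l (v i) = i"
    and w: "i < n \<Longrightarrow> w i < N" "i < n \<Longrightarrow> l (w i) = i"
    and v_neq_w: "i < n \<Longrightarrow> v i \<noteq> w i"
    and card_fibre: "i < n \<Longrightarrow> int (card {a. a < N \<and> l a = i}) = 2 * q i"
begin

definition entry :: "nat \<Rightarrow> nat \<Rightarrow> int" where
  "entry a b = 2 * of_bool (a = b) - of_bool (l a \<le> l b)"

definition form :: "(nat \<Rightarrow> int) \<Rightarrow> (nat \<Rightarrow> int) \<Rightarrow> int" where
  "form x y = (\<Sum>a<N. \<Sum>b<N. x a * entry a b * y b)"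

lemma form_add: "form (x + x') y = form x y + form x' y" "form x (y + y') = form x y + form x y'"
  by (simp_all add: form_def algebra_simps sum.distrib)

lemma form_scale: "form (coord_scale c x) y = c * form x y" "form x (coord_scale c y) = c * form x y"
  by (simp_all add: form_def coord_scale_def sum_distrib_left mult_ac)

lemma form_zero: "form 0 y = 0" "form x 0 = 0"
  by (simp_all add: form_def)

lemma form_diff: "form (x - x') y = form x y - form x' y" "form x (y - y') = form x y - form x y'"
  using form_add(1)[of "x - x'" x' y] form_add(2)[of x "y - y'" y'] by simp_all

lemma form_sum:
  "form (sum f A) y = (\<Sum>a\<in>A. form (f a) y)" "form x (sum f A) = (\<Sum>a\<in>A. form x (f a))"
  by (induction A rule: infinite_finite_induct) (simp_all add: form_zero form_add)

lemmas form_simps = form_add form_diff form_scale form_zero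

lemma form_unit: "a < N \<Longrightarrow> b < N \<Longrightarrow> form (unit a) (unit b) = entry a b"
proof -
  assume ab: "a < N" "b < N"
  have "form (unit a) (unit b)
      = (\<Sum>x<N. \<Sum>y<N. if y = b then (if x = a then entry x y else 0) else 0)"
    unfolding form_def unit_def by (intro sum.cong) auto
  also have "\<dots> = entry a b" using ab by simp
  finally show ?thesis .
qed

definition fibre :: "nat \<Rightarrow> nat \<Rightarrow> int" where
  "fibre i = (\<Sum>a | a < N \<and> l a = i. unit a)"

lemma form_fibre_unit:
  assumes "i < n" "b < N"
  shows "form (fibre i) (unit b) = 2 * of_bool (l b = i) - 2 * q i * of_bool (i \<le> l b)"
proof -
  have "form (fibre i) (unit b) = (\<Sum>a | a < N \<and> l a = i. 2 * of_bool (a = b) - of_bool (i \<le> l b))"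
    unfolding fibre_def form_sum using assms by (intro sum.cong) (auto simp: form_unit entry_def)
  also have "\<dots> = 2 * (\<Sum>a | a < N \<and> l a = i. of_bool (a = b))
      - int (card {a. a < N \<and> l a = i}) * of_bool (i \<le> l b)"
    by (simp add: sum_subtractf sum_distrib_left)
  also have "(\<Sum>a | a < N \<and> l a = i. of_bool (a = b)) = (of_bool (l b = i) :: int)"
    using assms by (simp add: of_bool_def)
  finally show ?thesis using assms by (simp add: card_fibre)
qed

lemma form_unit_fibre:
  assumes "i < n" "b < N"
  shows "form (unit b) (fibre i) = 2 * of_bool (l b = i) - 2 * q i * of_bool (l b \<le> i)"
proof -
  have "form (unit b) (fibre i) = (\<Sum>a | a < N \<and> l a = i. 2 * of_bool (a = b) - of_bool (l b \<le> i))"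
    unfolding fibre_def form_sum using assms by (intro sum.cong) (auto simp: form_unit entry_def)
  also have "\<dots> = 2 * (\<Sum>a | a < N \<and> l a = i. of_bool (a = b))
      - int (card {a. a < N \<and> l a = i}) * of_bool (l b \<le> i)"
    by (simp add: sum_subtractf sum_distrib_left)
  also have "(\<Sum>a | a < N \<and> l a = i. of_bool (a = b)) = (of_bool (l b = i) :: int)"
    using assms by (simp add: of_bool_def)
  finally show ?thesis using assms by (simp add: card_fibre)
qed

lemma form_fibre_fibre:
  assumes "i < n" "j < n"
  shows "form (fibre i) (fibre j) = 4 * q i * of_bool (i = j) - 4 * q i * q j * of_bool (i \<le> j)"
proof -
  have "form (fibre i) (fibre j)
      = (\<Sum>a | a < N \<and> l a = i. 2 * of_bool (i = j) - 2 * q j * of_bool (i \<le> j))"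
    unfolding fibre_def[of i] form_sum using assms by (intro sum.cong) (auto simp: form_unit_fibre)
  also have "\<dots> = 2 * q i * (2 * of_bool (i = j) - 2 * q j * of_bool (i \<le> j))"
    using assms by (simp add: card_fibre)
  finally show ?thesis by (simp add: algebra_simps)
qed

section \<open>Diagonalising families\<close>

definition others :: "nat set" where
  "others = {a. a < N \<and> a \<noteq> v (l a) \<and> a \<noteq> w (l a)}"

text \<open>
  These differences invert the unitriangular pairing \<open>[i \<le> j]\<close> of the levels.
\<close>
definition row_link :: "nat \<Rightarrow> nat \<Rightarrow> int" where
  "row_link i = unit (w i) - (if Suc i < n then unit (w (Suc i)) else 0)"

definition row_twin :: "nat \<Rightarrow> nat \<Rightarrow> int" where
  "row_twin a = unit a - unit (w (l a))"

text \<open>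
  The multiple of \<open>unit (w i)\<close> makes the level sum zero, and the multiple of \<open>row_link i\<close>
  then clears the pairing with \<open>unit (v i)\<close>.
\<close>
definition row_fibre :: "nat \<Rightarrow> nat \<Rightarrow> int" where
  "row_fibre i = fibre i - coord_scale (2 * q i) (unit (w i)) + coord_scale 2 (row_link i)"

text \<open>
  Against \<open>col_fibre\<close> the vectors \<open>row_fibre i\<close> form a bidiagonal matrix with \<open>4 * (1 - q i)\<close> on
  the diagonal and \<open>-4\<close> to its right. The recursion cancels the diagonal entries by the entries
  above them and moves their products into the first column.
\<close>
primrec row_chain :: "nat \<Rightarrow> nat \<Rightarrow> int" where
  "row_chain 0 = row_fibre 0"
| "row_chain (Suc i) = row_fibre (Suc i) + coord_scale (1 - q (Suc i)) (row_chain i)"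

definition col_twin :: "nat \<Rightarrow> nat \<Rightarrow> int" where
  "col_twin a = unit a - unit (v (l a))"

text \<open>
  The counterpart of \<open>row_fibre\<close>: the first two terms have level sum zero, the other two clear
  the pairings with \<open>row_link i\<close> and \<open>row_link (i - 1)\<close>.
\<close>
definition col_fibre :: "nat \<Rightarrow> nat \<Rightarrow> int" where
  "col_fibre i = fibre i - coord_scale (2 * q i) (unit (v i)) + coord_scale 2 (unit (v i))
     - coord_scale 2 (if i = 0 then 0 else unit (v (i - 1)))"

text \<open>
  Shifted by one so that \<open>col_chain i\<close> meets the entry \<open>-4\<close> of \<open>row_chain i\<close>; the last index
  takes the combination of all columns in which the first column of products cancels except
  in the last row.
\<close>
definition col_chain :: "nat \<Rightarrow> nat \<Rightarrow> int" where
  "col_chain i = (if Suc i < n then col_fibre (Suc i)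
     else (\<Sum>j<n. coord_scale (\<Prod>t<j. 1 - q t) (col_fibre j)))"

lemma representatives_simps [simp]:
  assumes "i < n" "j < n"
  shows "v i = v j \<longleftrightarrow> i = j" "w i = w j \<longleftrightarrow> i = j" "v i \<noteq> w j" "w j \<noteq> v i"
  using assms v w v_neq_w by metis+

lemma others_less: "a \<in> others \<Longrightarrow> a < N" "a \<in> others \<Longrightarrow> l a < n"
  using level_less by (auto simp: others_def)

lemma others_neq:
  assumes "a \<in> others" "i < n"
  shows "a \<noteq> v i" "a \<noteq> w i" "v i \<noteq> a" "w i \<noteq> a"
  using assms v w by (auto simp: others_def)

lemmas othersD = others_less others_neq

lemmas gram_simps = form_simps form_unit form_fibre_unit form_unit_fibre form_fibre_fibre entry_def
  of_bool_def

lemma gram_row_link: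
  assumes "i < n"
  shows "j < n \<Longrightarrow> form (row_link i) (unit (v j)) = - of_bool (i = j)"
    and "b \<in> others \<Longrightarrow> form (row_link i) (col_twin b) = 0"
    and "j < n \<Longrightarrow> form (row_link i) (col_fibre j) = 0"
proof -
  show "j < n \<Longrightarrow> form (row_link i) (unit (v j)) = - of_bool (i = j)"
    using assms by (auto simp: row_link_def gram_simps v w)
  show "b \<in> others \<Longrightarrow> form (row_link i) (col_twin b) = 0"
    using assms by (auto simp: row_link_def col_twin_def gram_simps v w othersD)
  show "j < n \<Longrightarrow> form (row_link i) (col_fibre j) = 0"
    using assms by (auto simp: row_link_def col_fibre_def gram_simps v w)
qed

lemma gram_row_twin:
  assumes "a \<in> others"
  shows "j < n \<Longrightarrow> form (row_twin a) (unit (v j)) = 0"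
    and "b \<in> others \<Longrightarrow> form (row_twin a) (col_twin b) = 2 * of_bool (a = b)"
    and "j < n \<Longrightarrow> form (row_twin a) (col_fibre j) = 0"
proof -
  show "j < n \<Longrightarrow> form (row_twin a) (unit (v j)) = 0"
    using assms by (auto simp: row_twin_def gram_simps v w othersD)
  show "b \<in> others \<Longrightarrow> form (row_twin a) (col_twin b) = 2 * of_bool (a = b)"
    using assms by (auto simp: row_twin_def col_twin_def gram_simps v w othersD)
  show "j < n \<Longrightarrow> form (row_twin a) (col_fibre j) = 0"
    using assms by (auto simp: row_twin_def col_fibre_def gram_simps v w othersD)
qed

lemma gram_row_fibre:
  assumes "i < n"
  shows "j < n \<Longrightarrow> form (row_fibre i) (unit (v j)) = 0"
    and "b \<in> others \<Longrightarrow> form (row_fibre i) (col_twin b) = 0"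
    and "j < n \<Longrightarrow> form (row_fibre i) (col_fibre j) = 4 * (1 - q i) * of_bool (i = j) - 4 * of_bool (j = Suc i)"
proof -
  show "j < n \<Longrightarrow> form (row_fibre i) (unit (v j)) = 0"
    using assms by (auto simp: row_fibre_def gram_simps gram_row_link v w)
  show "b \<in> others \<Longrightarrow> form (row_fibre i) (col_twin b) = 0"
    using assms gram_row_link(2)[of i b]
    by (auto simp: row_fibre_def form_simps) (auto simp: col_twin_def gram_simps v w othersD)
  show "j < n \<Longrightarrow> form (row_fibre i) (col_fibre j) = 4 * (1 - q i) * of_bool (i = j) - 4 * of_bool (j = Suc i)"
    using assms gram_row_link(3)[of i j]
    by (auto simp: row_fibre_def form_simps) (auto simp: col_fibre_def gram_simps v w algebra_simps)
qed

lemma gram_row_chain: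
  assumes "i < n"
  shows "j < n \<Longrightarrow> form (row_chain i) (unit (v j)) = 0"
    and "b \<in> others \<Longrightarrow> form (row_chain i) (col_twin b) = 0"
    and "j < n \<Longrightarrow> form (row_chain i) (col_fibre j)
      = 4 * (\<Prod>t<Suc i. 1 - q t) * of_bool (j = 0) - 4 * of_bool (j = Suc i)"
proof -
  show "j < n \<Longrightarrow> form (row_chain i) (unit (v j)) = 0"
    using assms by (induction i) (simp_all add: gram_row_fibre form_add form_scale)
  show "b \<in> others \<Longrightarrow> form (row_chain i) (col_twin b) = 0"
    using assms by (induction i) (simp_all add: gram_row_fibre form_add form_scale)
  show "j < n \<Longrightarrow> form (row_chain i) (col_fibre j)
      = 4 * (\<Prod>t<Suc i. 1 - q t) * of_bool (j = 0) - 4 * of_bool (j = Suc i)"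
    using assms by (induction i) (auto simp: gram_row_fibre form_add form_scale)
qed

lemma gram_col_chain:
  assumes "j < n"
  shows "i < n \<Longrightarrow> form (row_link i) (col_chain j) = 0"
    and "a \<in> others \<Longrightarrow> form (row_twin a) (col_chain j) = 0"
    and "i < n \<Longrightarrow> form (row_chain i) (col_chain j)
      = (if i = j then if Suc i < n then -4 else 4 * (\<Prod>t<n. 1 - q t) else 0)"
proof -
  show "i < n \<Longrightarrow> form (row_link i) (col_chain j) = 0"
    by (auto simp: col_chain_def form_sum form_scale gram_row_link)
  show "a \<in> others \<Longrightarrow> form (row_twin a) (col_chain j) = 0"
    by (auto simp: col_chain_def form_sum form_scale gram_row_twin)
  assume i: "i < n"
  show "form (row_chain i) (col_chain j)
      = (if i = j then if Suc i < n then -4 else 4 * (\<Prod>t<n. 1 - q t) else 0)"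
  proof (cases "Suc j < n")
    case True
    then show ?thesis using i by (auto simp: col_chain_def gram_row_chain)
  next
    case False
    then have j: "n = Suc j" using assms by simp
    \<comment> \<open>Only \<open>s = 0\<close> and \<open>s = Suc i\<close> contribute; they cancel unless \<open>Suc i\<close> is out of range.\<close>
    have "form (row_chain i) (col_chain j)
        = (\<Sum>s<n. (\<Prod>t<s. 1 - q t) * (4 * (\<Prod>t<Suc i. 1 - q t) * of_bool (s = 0) - 4 * of_bool (s = Suc i)))"
      using False i by (simp add: col_chain_def form_sum form_scale gram_row_chain del: prod.lessThan_Suc)
    also have "\<dots> = (\<Sum>s<n. if s = 0 then 4 * (\<Prod>t<Suc i. 1 - q t) else 0)
        - (\<Sum>s<n. if s = Suc i then 4 * (\<Prod>t<Suc i. 1 - q t) else 0)"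
      unfolding sum_subtractf[symmetric] by (intro sum.cong) (auto simp del: prod.lessThan_Suc)
    also have "\<dots> = (if i = j then 4 * (\<Prod>t<n. 1 - q t) else 0)"
      using i j by (auto simp del: prod.lessThan_Suc)
    finally show ?thesis using j by auto
  qed
qed

section \<open>The families generate the standard lattice\<close>

definition std_span :: "(nat \<Rightarrow> int) set" where
  "std_span = coord.span (unit ` {..<N})"

lemma unit_in_std_span: "a < N \<Longrightarrow> unit a \<in> std_span"
  unfolding std_span_def by (intro coord.span_base) auto

lemma fibre_in_std_span: "fibre i \<in> std_span"
  unfolding fibre_def std_span_def by (intro coord.span_sum coord.span_base) auto

lemmas std_span_intros =
  unit_in_std_span fibre_in_std_span
  coord.span_zero[of "unit ` {..<N}", folded std_span_def]
  coord.span_add[of _ "unit ` {..<N}", folded std_span_def]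
  coord.span_diff[of _ "unit ` {..<N}", folded std_span_def]
  coord.span_scale[of _ "unit ` {..<N}", folded std_span_def]
  coord.span_sum[of _ _ "unit ` {..<N}", folded std_span_def]

lemma row_families_in_std_span:
  "i < n \<Longrightarrow> row_link i \<in> std_span"
  "a \<in> others \<Longrightarrow> row_twin a \<in> std_span"
  "i < n \<Longrightarrow> row_chain i \<in> std_span"
proof -
  show link: "row_link i \<in> std_span" if "i < n" for i
    using that w by (auto simp: row_link_def intro!: std_span_intros)
  show "row_twin a \<in> std_span" if "a \<in> others"
    using that w by (auto simp: row_twin_def othersD intro!: std_span_intros)
  have "row_fibre i \<in> std_span" if "i < n" for i
    using that w link by (auto simp: row_fibre_def intro!: std_span_intros)
  then show "i < n \<Longrightarrow> row_chain i \<in> std_span"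
    by (induction i) (auto intro!: std_span_intros)
qed

lemma col_families_in_std_span:
  "i < n \<Longrightarrow> unit (v i) \<in> std_span"
  "a \<in> others \<Longrightarrow> col_twin a \<in> std_span"
  "i < n \<Longrightarrow> col_chain i \<in> std_span"
proof -
  show "i < n \<Longrightarrow> unit (v i) \<in> std_span"
    using v by (auto intro!: std_span_intros)
  show "a \<in> others \<Longrightarrow> col_twin a \<in> std_span"
    using v by (auto simp: col_twin_def othersD intro!: std_span_intros)
  have "col_fibre i \<in> std_span" if "i < n" for i
    using that v by (auto simp: col_fibre_def intro!: std_span_intros)
  then show "i < n \<Longrightarrow> col_chain i \<in> std_span"
    by (auto simp: col_chain_def intro!: std_span_intros)
qed

lemma fibre_split:
  assumes "i < n"
  shows "fibre i = unit (v i) + unit (w i) + (\<Sum>a | a \<in> others \<and> l a = i. unit a)"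
proof -
  have "{a. a < N \<and> l a = i} = insert (v i) (insert (w i) {a. a \<in> others \<and> l a = i})"
    using assms v w by (auto simp: others_def)
  moreover have "finite {a. a \<in> others \<and> l a = i}"
    by (rule finite_subset[of _ "{..<N}"]) (auto simp: others_def)
  ultimately show ?thesis
    using assms v w by (simp add: fibre_def v_neq_w others_def add.assoc)
qed

text \<open>
  The construction is undone in order: the links give the \<open>w i\<close> from the top level downwards, the
  twins all other points except the \<open>v i\<close>, the chains the fibre sums, and these finally
  the \<open>v i\<close>.
\<close>
lemma unit_in_span_rows:
  assumes link: "\<And>i. i < n \<Longrightarrow> row_link i \<in> coord.span T"
    and twin: "\<And>a. a \<in> others \<Longrightarrow> row_twin a \<in> coord.span T"
    and chain: "\<And>i. i < n \<Longrightarrow> row_chain i \<in> coord.span T"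
    and "a < N"
  shows "unit a \<in> coord.span T"
proof -
  have w_span: "unit (w i) \<in> coord.span T" if "i < n" for i
    using that
  proof (induction "n - i" arbitrary: i)
    case (Suc d)
    have "unit (w i) = row_link i + (if Suc i < n then unit (w (Suc i)) else 0)"
      by (simp add: row_link_def)
    moreover have "Suc i < n \<Longrightarrow> unit (w (Suc i)) \<in> coord.span T"
      using Suc by auto
    ultimately show ?case
      using link[OF Suc.prems] by (auto intro: coord.span_add coord.span_zero)
  qed simp
  have others_span: "unit a \<in> coord.span T" if "a \<in> others" for a
    using coord.span_add[OF twin[OF that] w_span[of "l a"]] that by (simp add: row_twin_def othersD)
  have row_fibre_span: "row_fibre i \<in> coord.span T" if "i < n" for i
  proof (cases i)
    case 0
    then show ?thesis using chain[of 0] that by simp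
  next
    case (Suc j)
    then have "row_fibre i = row_chain i - coord_scale (1 - q i) (row_chain j)"
      by simp
    then show ?thesis
      using chain[of i] chain[of j] that Suc by (simp only:) (intro coord.span_diff coord.span_scale; simp)
  qed
  have fibre_span: "fibre i \<in> coord.span T" if "i < n" for i
  proof -
    have "fibre i = row_fibre i - coord_scale 2 (row_link i) + coord_scale (2 * q i) (unit (w i))"
      by (simp add: row_fibre_def)
    then show ?thesis
      using that by (simp only:) (intro coord.span_diff coord.span_add coord.span_scale row_fibre_span link w_span)
  qed
  have v_span: "unit (v i) \<in> coord.span T" if "i < n" for i
  proof -
    have "unit (v i) = fibre i - unit (w i) - (\<Sum>a | a \<in> others \<and> l a = i. unit a)"
      using that by (simp add: fibre_split)
    then show ?thesis
      using that by (simp only:) (intro coord.span_diff coord.span_sum fibre_span w_span others_span; simp)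
  qed
  show ?thesis
    using v_span[of "l a"] w_span[of "l a"] others_span[of a] level_less[of a] \<open>a < N\<close>
    by (cases "a \<in> others") (auto simp: others_def)
qed

text \<open>
  As for the rows, with the roles of \<open>v\<close> and \<open>w\<close> exchanged. The first fibre column is recovered
  from the last chain column, in which it has coefficient \<open>1\<close>.
\<close>
lemma unit_in_span_cols:
  assumes v_span: "\<And>i. i < n \<Longrightarrow> unit (v i) \<in> coord.span T"
    and twin: "\<And>a. a \<in> others \<Longrightarrow> col_twin a \<in> coord.span T"
    and chain: "\<And>i. i < n \<Longrightarrow> col_chain i \<in> coord.span T"
    and "a < N"
  shows "unit a \<in> coord.span T"
proof -
  have others_span: "unit a \<in> coord.span T" if "a \<in> others" for a
    using coord.span_add[OF twin[OF that] v_span[of "l a"]] that by (simp add: col_twin_def othersD)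
  have col_fibre_Suc: "col_fibre (Suc i) \<in> coord.span T" if "Suc i < n" for i
    using chain[of i] that by (simp add: col_chain_def)
  have col_fibre_span: "col_fibre i \<in> coord.span T" if "i < n" for i
  proof (cases i)
    case 0
    obtain n' where n': "n = Suc n'"
      using less_imp_Suc_add[OF \<open>i < n\<close>] by blast
    have "col_chain n' = (\<Sum>j<Suc n'. coord_scale (\<Prod>t<j. 1 - q t) (col_fibre j))"
      by (simp add: col_chain_def flip: n')
    also have "\<dots> = col_fibre 0 + (\<Sum>j<n'. coord_scale (\<Prod>t<Suc j. 1 - q t) (col_fibre (Suc j)))"
      by (subst sum.lessThan_Suc_shift) (simp del: prod.lessThan_Suc)
    finally have "col_fibre 0
        = col_chain n' - (\<Sum>j<n'. coord_scale (\<Prod>t<Suc j. 1 - q t) (col_fibre (Suc j)))"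
      by (simp del: prod.lessThan_Suc)
    then show ?thesis
      unfolding 0 by (simp only:) (intro coord.span_diff coord.span_sum coord.span_scale chain col_fibre_Suc; simp add: n')
  next
    case (Suc j)
    then show ?thesis using col_fibre_Suc that by simp
  qed
  have fibre_span: "fibre i \<in> coord.span T" if "i < n" for i
  proof -
    have "fibre i = col_fibre i + coord_scale (2 * q i) (unit (v i)) - coord_scale 2 (unit (v i))
        + coord_scale 2 (if i = 0 then 0 else unit (v (i - 1)))"
      by (simp add: col_fibre_def)
    moreover have "(if i = 0 then 0 else unit (v (i - 1))) \<in> coord.span T"
      using that v_span[of "i - 1"] by (auto intro: coord.span_zero)
    ultimately show ?thesis
      using that by (simp only:) (intro coord.span_diff coord.span_add coord.span_scale col_fibre_span v_span)
  qed
  have w_span: "unit (w i) \<in> coord.span T" if "i < n" for i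
  proof -
    have "unit (w i) = fibre i - unit (v i) - (\<Sum>a | a \<in> others \<and> l a = i. unit a)"
      using that by (simp add: fibre_split)
    then show ?thesis
      using that by (simp only:) (intro coord.span_diff coord.span_sum fibre_span v_span others_span; simp)
  qed
  show ?thesis
    using v_span[of "l a"] w_span[of "l a"] others_span[of a] level_less[of a] \<open>a < N\<close>
    by (cases "a \<in> others") (auto simp: others_def)
qed

section \<open>Determinantal divisors of a level matrix\<close>

definition slots :: "slot set" where
  "slots = Link ` {..<n} \<union> Twin ` others \<union> Chain ` {..<n}"

primrec row_of :: "slot \<Rightarrow> nat \<Rightarrow> int" where
  "row_of (Link i) = row_link i"
| "row_of (Twin a) = row_twin a"
| "row_of (Chain i) = row_chain i"

primrec col_of :: "slot \<Rightarrow> nat \<Rightarrow> int" where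
  "col_of (Link i) = unit (v i)"
| "col_of (Twin a) = col_twin a"
| "col_of (Chain i) = col_chain i"

primrec diag :: "slot \<Rightarrow> int" where
  "diag (Link i) = -1"
| "diag (Twin a) = 2"
| "diag (Chain i) = (if Suc i < n then -4 else 4 * (\<Prod>t<n. 1 - q t))"

lemma form_row_of_col_of:
  assumes "a \<in> slots" "b \<in> slots"
  shows "form (row_of a) (col_of b) = (if a = b then diag a else 0)"
  using assms
  by (auto simp: slots_def gram_row_link gram_row_twin gram_row_chain gram_col_chain
           split: if_splits)

lemma finite_others: "finite others"
  by (rule finite_subset[of _ "{..<N}"]) (auto simp: others_def)

lemma card_others: "card others + 2 * n = N"
proof -
  have "{..<N} = others \<union> (v ` {..<n} \<union> w ` {..<n})"
    using v w level_less by (auto simp: others_def)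
  moreover have "others \<inter> (v ` {..<n} \<union> w ` {..<n}) = {}"
    by (auto dest: othersD)
  moreover have "card (v ` {..<n} \<union> w ` {..<n}) = 2 * n"
  proof -
    have "v ` {..<n} \<inter> w ` {..<n} = {}" by auto
    then show ?thesis
      by (simp add: card_Un_disjoint card_image inj_on_def)
  qed
  ultimately show ?thesis
    using card_Un_disjoint[of others "v ` {..<n} \<union> w ` {..<n}"] finite_others
    by (metis card_lessThan finite_UnI finite_imageI finite_lessThan)
qed

lemma common_divisors_minors:
  "(\<forall>m \<in> minors (mat N N (\<lambda>(a, b). entry a b)) k. d dvd m)
    \<longleftrightarrow> (\<forall>S. S \<subseteq> slots \<and> card S = k \<longrightarrow> d dvd (\<Prod>a\<in>S. diag a))"
proof (rule coord.common_divisors_minors_diagonal[where \<beta> = form and e = unit and r = row_of and c = col_of])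
  show "a \<in> slots \<Longrightarrow> row_of a \<in> coord.span (unit ` {..<N})" for a
    using row_families_in_std_span by (auto simp: slots_def std_span_def)
  show "a \<in> slots \<Longrightarrow> col_of a \<in> coord.span (unit ` {..<N})" for a
    using col_families_in_std_span by (auto simp: slots_def std_span_def)
  show "a < N \<Longrightarrow> unit a \<in> coord.span (row_of ` slots)" for a
    by (rule unit_in_span_rows) (force simp: slots_def intro!: coord.span_base)+
  show "a < N \<Longrightarrow> unit a \<in> coord.span (col_of ` slots)" for a
    by (rule unit_in_span_cols) (force simp: slots_def intro!: coord.span_base)+
  show "finite slots"
    by (simp add: slots_def finite_others)
qed (simp_all add: form_add form_scale form_unit form_row_of_col_of)

lemma Gcd_minors:
  "Gcd (minors (mat N N (\<lambda>(a, b). entry a b)) k) = Gcd {\<Prod>a\<in>S. diag a | S. S \<subseteq> slots \<and> card S = k}"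
  (is "Gcd ?A = Gcd ?B")
proof -
  have "(\<forall>a\<in>?A. d dvd a) \<longleftrightarrow> (\<forall>b\<in>?B. d dvd b)" for d
    unfolding common_divisors_minors by (simp add: setcompr_eq_image)
  then have "Gcd ?A dvd Gcd ?B" "Gcd ?B dvd Gcd ?A"
    by (meson Gcd_dvd Gcd_greatest)+
  then show ?thesis
    by (intro zdvd_antisym_nonneg) auto
qed

lemma card_slots: "card slots = N"
proof -
  have "card slots = card (Link ` {..<n} \<union> Twin ` others) + card (Chain ` {..<n})"
    unfolding slots_def using finite_others by (intro card_Un_disjoint) auto
  also have "card (Link ` {..<n} \<union> Twin ` others) = card (Link ` {..<n}) + card (Twin ` others)"
    using finite_others by (intro card_Un_disjoint) auto
  finally show ?thesis
    using card_others by (simp add: card_image inj_on_def)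
qed

lemma prod_diag_slots: "\<bar>\<Prod>a\<in>slots. diag a\<bar> = 2 ^ N * (\<Prod>t<n. \<bar>1 - q t\<bar>)"
proof -
  have "(\<Prod>a\<in>slots. diag a) = (\<Prod>a\<in>Link ` {..<n}. diag a) * (\<Prod>a\<in>Twin ` others. diag a) * (\<Prod>a\<in>Chain ` {..<n}. diag a)"
    unfolding slots_def using finite_others
    by (subst prod.union_disjoint; (subst prod.union_disjoint)?) auto
  moreover have "(\<Prod>a\<in>Link ` {..<n}. diag a) = (-1) ^ n" "(\<Prod>a\<in>Twin ` others. diag a) = 2 ^ card others"
    by (simp_all add: prod.reindex inj_on_def)
  moreover have "\<bar>\<Prod>a\<in>Chain ` {..<n}. diag a\<bar> = 4 ^ n * (\<Prod>t<n. \<bar>1 - q t\<bar>)"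
  proof (cases n)
    case (Suc m)
    have Suc_less: "i < m \<Longrightarrow> Suc i < n" for i
      by (simp add: Suc)
    have "(\<Prod>i<m. diag (Chain i)) = (-4) ^ m"
      using Suc_less by simp
    moreover have "diag (Chain m) = 4 * (\<Prod>t<n. 1 - q t)"
      by (simp flip: Suc)
    moreover have "(\<Prod>a\<in>Chain ` {..<n}. diag a) = (\<Prod>i<n. diag (Chain i))"
      by (subst prod.reindex) (auto simp: inj_on_def)
    moreover have "\<dots> = (\<Prod>i<m. diag (Chain i)) * diag (Chain m)"
      unfolding Suc lessThan_Suc by (simp add: mult.commute)
    ultimately have "(\<Prod>a\<in>Chain ` {..<n}. diag a) = (-4) ^ m * (4 * (\<Prod>t<n. 1 - q t))"
      by simp
    then show ?thesis
      by (simp only: abs_mult power_abs abs_prod) (simp add: Suc)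
  qed simp
  ultimately have "\<bar>\<Prod>a\<in>slots. diag a\<bar> = 2 ^ card others * (4 ^ n * (\<Prod>t<n. \<bar>1 - q t\<bar>))"
    by (simp add: abs_mult power_abs)
  moreover have "2 ^ card others * (4 ^ n :: int) = 2 ^ (card others + 2 * n)"
    by (simp add: power_add power_mult)
  ultimately show ?thesis by (simp only: card_others mult.assoc[symmetric])
qed

text \<open>
  Every slot that is not a link contributes a factor \<open>2\<close>, every chain slot one more. Among \<open>k\<close>
  slots at least \<open>k - n\<close> are not links and at least \<open>k - (N - n)\<close> are chains.
\<close>
lemma power_two_dvd_prod_diag:
  assumes S: "S \<subseteq> slots" "card S = k"
  shows "2 ^ (k - n + (k - (N - n))) dvd (\<Prod>a\<in>S. diag a)"
proof -
  define \<epsilon> :: "slot \<Rightarrow> nat" where "\<epsilon> a = of_bool (a \<notin> range Link) + of_bool (a \<in> range Chain)" for a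
  have fin: "finite S"
    using S(1) finite_others by (auto simp: slots_def intro: finite_subset)
  have dvd: "2 ^ \<epsilon> a dvd diag a" for a
    by (cases a) (auto simp: \<epsilon>_def image_iff)
  have "2 ^ (\<Sum>a\<in>S. \<epsilon> a) dvd (\<Prod>a\<in>S. diag a)"
    unfolding power_sum using dvd by (rule prod_dvd_prod)
  moreover have "k - n + (k - (N - n)) \<le> (\<Sum>a\<in>S. \<epsilon> a)"
  proof -
    have "(\<Sum>a\<in>S. \<epsilon> a) = card (S - range Link) + card (S \<inter> range Chain)"
      using fin by (simp add: \<epsilon>_def sum.distrib of_bool_def sum.If_cases Int_def Diff_eq Compl_eq)
    moreover have "k - n \<le> card (S - range Link)"
    proof -
      have "S \<inter> range Link \<subseteq> Link ` {..<n}"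
        using S(1) by (auto simp: slots_def)
      then have "card (S \<inter> range Link) \<le> n"
        using card_mono[of "Link ` {..<n}" "S \<inter> range Link"] by (simp add: card_image inj_on_def)
      then show ?thesis
        using S(2) fin card_Diff_subset_Int[of S "range Link"] by simp
    qed
    moreover have "k - (N - n) \<le> card (S \<inter> range Chain)"
    proof -
      have "S - range Chain \<subseteq> Link ` {..<n} \<union> Twin ` others"
        using S(1) by (auto simp: slots_def)
      then have "card (S - range Chain) \<le> card (Link ` {..<n} \<union> Twin ` others)"
        using finite_others by (intro card_mono) auto
      also have "\<dots> = n + card others"
        using finite_others by (subst card_Un_disjoint) (auto simp: card_image inj_on_def)
      finally have "card (S - range Chain) \<le> N - n"
        using card_others by simp
      moreover have "card S = card (S - range Chain) + card (S \<inter> range Chain)"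
        using fin card_Diff_subset_Int[of S "range Chain"] card_mono[of S "S \<inter> range Chain"] by simp
      ultimately show ?thesis using S(2) by simp
    qed
    ultimately show ?thesis by simp
  qed
  ultimately show ?thesis
    by (meson dvd_trans le_imp_power_dvd)
qed

text \<open>
  The bound is attained by taking links first, then twins, then chains. Since \<open>k < N\<close>, the
  last chain slot, whose value may contain further factors or vanish, is avoided.
\<close>
lemma ex_slots_prod_diag:
  assumes "k < N"
  shows "\<exists>S. S \<subseteq> slots \<and> card S = k \<and> \<bar>\<Prod>a\<in>S. diag a\<bar> = 2 ^ (k - n + (k - (N - n)))"
proof -
  consider "k \<le> n" | "n < k" "k \<le> N - n" | "N - n < k" by linarith
  then show ?thesis
  proof cases
    case 1
    have "\<bar>\<Prod>a\<in>Link ` {..<k}. diag a\<bar> = 1"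
      by (simp add: prod.reindex inj_on_def power_abs)
    moreover have "k - (N - n) = 0"
      using 1 card_others by simp
    ultimately show ?thesis
      using 1 by (intro exI[of _ "Link ` {..<k}"]) (auto simp: slots_def card_image inj_on_def)
  next
    case 2
    then have "k - n \<le> card others"
      using card_others by linarith
    then obtain O' where O': "O' \<subseteq> others" "card O' = k - n"
      by (rule obtain_subset_with_card_n)
    then have fin: "finite O'"
      using finite_others finite_subset by blast
    let ?S = "Link ` {..<n} \<union> Twin ` O'"
    have "card ?S = k"
      using fin O' 2 by (subst card_Un_disjoint) (auto simp: card_image inj_on_def)
    moreover have "\<bar>\<Prod>a\<in>?S. diag a\<bar> = 2 ^ (k - n)"
      using fin O' by (subst prod.union_disjoint) (auto simp: prod.reindex inj_on_def abs_mult power_abs)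
    ultimately show ?thesis
      using 2 O' by (intro exI[of _ ?S]) (auto simp: slots_def)
  next
    case 3
    define m where "m = k - (N - n)"
    have m: "m < n" "k = n + card others + m"
      using 3 assms card_others by (auto simp: m_def)
    let ?S = "(Link ` {..<n} \<union> Twin ` others) \<union> Chain ` {..<m}"
    have "card ?S = k"
      using finite_others m
      by (subst card_Un_disjoint; (subst card_Un_disjoint)?) (auto simp: card_image inj_on_def)
    moreover have "(\<Prod>a\<in>?S. diag a) = (-1) ^ n * 2 ^ card others * (-4) ^ m"
      using finite_others m
      by (subst prod.union_disjoint; (subst prod.union_disjoint)?)
         (auto simp: prod.reindex inj_on_def)
    then have "\<bar>\<Prod>a\<in>?S. diag a\<bar> = 2 ^ card others * 4 ^ m"
      by (simp add: abs_mult power_abs)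
    moreover have "(4 :: int) ^ m = 2 ^ (m + m)"
      by (simp add: power_add flip: power_mult_distrib)
    moreover have "k - n = card others + m" "k - (N - n) = m"
      using m card_others by auto
    moreover have "?S \<subseteq> slots"
      using m by (auto simp: slots_def)
    ultimately show ?thesis
      by (intro exI[of _ ?S]) (simp add: power_add)
  qed
qed

lemma Gcd_minors_entry:
  "k < N \<Longrightarrow> Gcd (minors (mat N N (\<lambda>(a, b). entry a b)) k) = 2 ^ (k - n + (k - (N - n)))"
  "Gcd (minors (mat N N (\<lambda>(a, b). entry a b)) N) = 2 ^ N * (\<Prod>t<n. \<bar>1 - q t\<bar>)"
proof -
  assume "k < N"
  then obtain S where S: "S \<subseteq> slots" "card S = k" "\<bar>\<Prod>a\<in>S. diag a\<bar> = 2 ^ (k - n + (k - (N - n)))"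
    using ex_slots_prod_diag by blast
  let ?B = "{\<Prod>a\<in>S. diag a | S. S \<subseteq> slots \<and> card S = k}"
  have "Gcd ?B dvd (\<Prod>a\<in>S. diag a)"
    using S by (intro Gcd_dvd) blast
  then have "Gcd ?B dvd 2 ^ (k - n + (k - (N - n)))"
    by (simp flip: S(3))
  moreover have "2 ^ (k - n + (k - (N - n))) dvd Gcd ?B"
    using power_two_dvd_prod_diag by (intro Gcd_greatest) auto
  ultimately have "Gcd ?B = 2 ^ (k - n + (k - (N - n)))"
    by (intro zdvd_antisym_nonneg) auto
  then show "Gcd (minors (mat N N (\<lambda>(a, b). entry a b)) k) = 2 ^ (k - n + (k - (N - n)))"
    by (simp add: Gcd_minors)
next
  have "finite slots" by (simp add: slots_def finite_others)
  then have "S \<subseteq> slots \<and> card S = N \<longleftrightarrow> S = slots" for S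
    using card_slots card_subset_eq[of slots S] by (metis order_refl)
  then have "{\<Prod>a\<in>S. diag a | S. S \<subseteq> slots \<and> card S = N} = {\<Prod>a\<in>slots. diag a}"
    by simp
  then show "Gcd (minors (mat N N (\<lambda>(a, b). entry a b)) N) = 2 ^ N * (\<Prod>t<n. \<bar>1 - q t\<bar>)"
    by (simp add: Gcd_minors prod_diag_slots)
qed

end

section \<open>Levels in a cyclic group of prime power order\<close>

lemma levels_exI:
  assumes "\<And>a. a < N \<Longrightarrow> l a < n"
    and card: "\<And>i. i < n \<Longrightarrow> int (card {a. a < N \<and> l a = i}) = 2 * q i"
    and pos: "\<And>i. i < n \<Longrightarrow> q i > 0"
  shows "\<exists>v w. levels N n l v w q"
proof -
  have "\<exists>x y. x < N \<and> l x = i \<and> y < N \<and> l y = i \<and> x \<noteq> y" if "i < n" for i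
  proof -
    have "2 \<le> card {a. a < N \<and> l a = i}"
      using card[OF that] pos[OF that] by linarith
    then obtain T where "T \<subseteq> {a. a < N \<and> l a = i}" "card T = 2"
      by (rule obtain_subset_with_card_n)
    then show ?thesis
      by (fastforce simp: card_2_iff)
  qed
  then obtain v w where "\<And>i. i < n \<Longrightarrow> v i < N \<and> l (v i) = i \<and> w i < N \<and> l (w i) = i \<and> v i \<noteq> w i"
    by metis
  then have "levels N n l v w q"
    using assms by unfold_locales auto
  then show ?thesis by blast
qed

lemma multiplicity_less_of_less_prime_power:
  fixes p :: nat and x :: int
  assumes "prime p" "0 < x" "x < int (p ^ n)"
  shows "multiplicity (int p) x < n"
proof (rule ccontr)
  assume "\<not> ?thesis"
  then have "int p ^ n dvd x"
    using multiplicity_dvd'[of n "int p" x] by simp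
  then show False
    using assms(2,3) zdvd_imp_le[of "int p ^ n" x] by simp
qed

text \<open>
  Write \<open>y\<close> as a power of \<open>p\<close> times \<open>y'\<close> with \<open>y'\<close> prime to \<open>p\<close>; an inverse of \<open>y'\<close>
  modulo \<open>p ^ n\<close> turns \<open>y\<close> into that power, of which \<open>x\<close> is a multiple. Conversely, the
  power divides \<open>p ^ n\<close>, hence survives the reduction.
\<close>
lemma multiple_mod_prime_power_iff:
  fixes p :: nat and x y :: int
  assumes p: "prime p" and x: "0 < x" "x < int (p ^ n)" and y: "0 < y" "y < int (p ^ n)"
  shows "(\<exists>m. x = (m * y) mod int (p ^ n)) \<longleftrightarrow> multiplicity (int p) y \<le> multiplicity (int p) x"
proof
  assume "\<exists>m. x = (m * y) mod int (p ^ n)"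
  then obtain m where m: "x = (m * y) mod int (p ^ n)" by blast
  have "int p ^ multiplicity (int p) y dvd int p ^ n"
    using multiplicity_less_of_less_prime_power[OF p y] by (intro le_imp_power_dvd) simp
  then have "int p ^ multiplicity (int p) y dvd x"
    unfolding m by (simp add: dvd_mod_iff multiplicity_dvd)
  then show "multiplicity (int p) y \<le> multiplicity (int p) x"
    using p x by (intro multiplicity_geI) auto
next
  assume le: "multiplicity (int p) y \<le> multiplicity (int p) x"
  obtain y' where y': "y = int p ^ multiplicity (int p) y * y'" "\<not> int p dvd y'"
    using multiplicity_decompose'[of y "int p"] y prime_gt_1_nat[OF p] by auto
  obtain x' where x': "x = int p ^ multiplicity (int p) y * x'"
    using multiplicity_dvd'[OF le] by (auto elim: dvdE)
  have "coprime (int p) y'"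
    using y'(2) p by (intro prime_imp_coprime) auto
  then have "coprime y' (int p ^ n)"
    by (simp add: coprime_commute)
  then obtain z where z: "[y' * z = 1] (mod int p ^ n)"
    using cong_solve_coprime_int by blast
  have "[x * (y' * z) = x * 1] (mod int p ^ n)"
    using z by (rule cong_scalar_left)
  moreover have "x * (y' * z) = (z * x') * (int p ^ multiplicity (int p) y * y')"
    by (subst x') (simp only: mult_ac)
  ultimately have "[(z * x') * y = x] (mod int p ^ n)"
    by (simp only: y'(1)[symmetric] mult_1_right)
  then have "x = ((z * x') * y) mod int (p ^ n)"
    using x by (simp add: cong_def)
  then show "\<exists>m. x = (m * y) mod int (p ^ n)" by blast
qed

lemma card_multiplicity_eq:
  fixes p :: nat
  assumes p: "prime p" and "i < n"
  shows "card {x :: int. 0 < x \<and> x < int (p ^ n) \<and> multiplicity (int p) x = i} = totient (p ^ (n - i))"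
proof -
  have gcd: "gcd x (p ^ n) = p ^ i \<longleftrightarrow> multiplicity (int p) (int x) = i"
    if "0 < x" "x < p ^ n" for x
  proof -
    have "multiplicity (int p) (int x) < n"
      using multiplicity_less_of_less_prime_power[OF p, of "int x" n] that by simp
    moreover obtain j where j: "j \<le> n" "gcd x (p ^ n) = p ^ j"
      using p by (metis divides_primepow_nat gcd_dvd2)
    then have "int p ^ j = gcd (int x) (int p ^ n)"
      by (metis gcd_int_int_eq of_nat_power)
    then have "multiplicity (int p) (int p ^ j) = min (multiplicity (int p) (int x)) (multiplicity (int p) (int p ^ n))"
      using that p by (simp add: multiplicity_gcd)
    ultimately have "j = multiplicity (int p) (int x)"
      using p by (simp add: multiplicity_prime_power)
    then show ?thesis
      using j prime_gt_1_nat[OF p] by simp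
  qed
  have "{x :: int. 0 < x \<and> x < int (p ^ n) \<and> multiplicity (int p) x = i}
      = int ` {x \<in> {0<..p ^ n}. gcd x (p ^ n) = p ^ i}"
  proof (intro equalityI subsetI)
    fix x assume "x \<in> {x :: int. 0 < x \<and> x < int (p ^ n) \<and> multiplicity (int p) x = i}"
    then show "x \<in> int ` {x \<in> {0<..p ^ n}. gcd x (p ^ n) = p ^ i}"
      using gcd[of "nat x"] by (intro image_eqI[of _ _ "nat x"]) (auto simp: nat_less_iff nat_le_iff)
  next
    fix x assume "x \<in> int ` {x \<in> {0<..p ^ n}. gcd x (p ^ n) = p ^ i}"
    then obtain y where y: "x = int y" "0 < y" "y \<le> p ^ n" "gcd y (p ^ n) = p ^ i" by auto
    moreover have "y \<noteq> p ^ n"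
      using y(4) \<open>i < n\<close> prime_gt_1_nat[OF p] by auto
    ultimately show "x \<in> {x :: int. 0 < x \<and> x < int (p ^ n) \<and> multiplicity (int p) x = i}"
      using gcd[of y] by auto
  qed
  then have "card {x :: int. 0 < x \<and> x < int (p ^ n) \<and> multiplicity (int p) x = i}
      = card {x \<in> {0<..p ^ n}. gcd x (p ^ n) = p ^ i}"
    by (simp add: card_image)
  also have "\<dots> = totient (p ^ n div p ^ i)"
    using p assms(2) by (intro card_gcd_eq_totient) (auto simp: prime_gt_0_nat le_imp_power_dvd)
  also have "p ^ n div p ^ i = p ^ (n - i)"
    using p assms(2) by (simp add: power_diff prime_gt_0_nat)
  finally show ?thesis .
qed

text \<open>
  The multiplicity of \<open>p\<close> decreases with the order of an element, so the comparison is
  between \<open>b\<close> and \<open>a\<close> in this order.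
\<close>
lemma laplacian_eq_level_matrix:
  fixes p n :: nat and vs :: "int list"
  defines "D \<equiv> with_proj (punctured_power_digraph (integer_mod_group (p ^ n)))"
  assumes p: "prime p" and vs: "distinct vs" "set vs = verts D"
  shows "1\<^sub>m (length vs) - transpose_mat (adjacency_mat D vs)
    = mat (length vs) (length vs) (\<lambda>(a, b). 2 * of_bool (a = b)
        - of_bool (multiplicity (int p) (vs ! b) \<le> multiplicity (int p) (vs ! a)))"
    and "set vs = {x. 0 < x \<and> x < int (p ^ n)}"
proof -
  have "carrier (integer_mod_group (p ^ n)) = {0..<int (p ^ n)}"
    using prime_gt_0_nat[OF p] unfolding carrier_integer_mod_group by (subst if_not_P) simp_all
  then have pverts: "carrier (integer_mod_group (p ^ n)) - {0} = {x. 0 < x \<and> x < int (p ^ n)}"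
    by (simp only:) (intro equalityI subsetI; simp)
  then show set_vs: "set vs = {x. 0 < x \<and> x < int (p ^ n)}"
    by (simp add: vs D_def punctured_power_digraph_def)
  have arcs: "(y, x) \<in> arcs D \<longleftrightarrow> x \<noteq> y \<and> multiplicity (int p) y \<le> multiplicity (int p) x"
    if "x \<in> set vs" "y \<in> set vs" for x y
    using that multiple_mod_prime_power_iff[OF p, of x n y]
    by (auto simp: set_vs D_def punctured_power_digraph_def pverts int_pow_integer_mod_group
             simp del: of_nat_power)
  have count: "int (card {e \<in> arcs D. tail D e = y \<and> head D e = x}) = of_bool ((y, x) \<in> arcs D)" for x y
  proof -
    have "{e \<in> arcs D. tail D e = y \<and> head D e = x} = (if (y, x) \<in> arcs D then {(y, x)} else {})"
      by (auto simp: D_def)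
    then show ?thesis by simp
  qed
  show "1\<^sub>m (length vs) - transpose_mat (adjacency_mat D vs)
    = mat (length vs) (length vs) (\<lambda>(a, b). 2 * of_bool (a = b)
        - of_bool (multiplicity (int p) (vs ! b) \<le> multiplicity (int p) (vs ! a)))"
  proof (rule eq_matI)
    fix a b
    assume "a < dim_row (mat (length vs) (length vs) (\<lambda>(a, b). 2 * of_bool (a = b)
        - of_bool (multiplicity (int p) (vs ! b) \<le> multiplicity (int p) (vs ! a)) :: int))"
      and "b < dim_col (mat (length vs) (length vs) (\<lambda>(a, b). 2 * of_bool (a = b)
        - of_bool (multiplicity (int p) (vs ! b) \<le> multiplicity (int p) (vs ! a)) :: int))"
    then have ab: "a < length vs" "b < length vs" by simp_all
    then have "vs ! a = vs ! b \<longleftrightarrow> a = b"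
      using vs(1) by (simp add: nth_eq_iff_index_eq)
    then show "(1\<^sub>m (length vs) - transpose_mat (adjacency_mat D vs)) $$ (a, b)
      = mat (length vs) (length vs) (\<lambda>(a, b). 2 * of_bool (a = b)
        - of_bool (multiplicity (int p) (vs ! b) \<le> multiplicity (int p) (vs ! a))) $$ (a, b)"
      using ab by (auto simp: adjacency_mat_def count arcs)
  qed (simp_all add: adjacency_mat_def)
qed

theorem theorem4:
  fixes p n k :: nat and vs :: "int list" and A :: "int mat"
  assumes "prime p" and "p \<ge> 3" and "n \<ge> 1"
    and "distinct vs"
    and "set vs = verts (with_proj (punctured_power_digraph (integer_mod_group (p ^ n))))"
    and "A = adjacency_mat (with_proj (punctured_power_digraph (integer_mod_group (p ^ n)))) vs"
    and "1 \<le> k" and "k \<le> p ^ n - 1"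
  shows "Gcd (minors (1\<^sub>m (p ^ n - 1) - transpose_mat A) k) =
    (if 1 \<le> k \<and> k \<le> n then 1
     else if n + 1 \<le> k \<and> k \<le> p ^ n - n - 1 then 2 ^ (k - n)
     else if p ^ n - n \<le> k \<and> k \<le> p ^ n - 2 then 2 ^ (2 * k - p ^ n + 1)
     else \<bar>\<Prod>i = 1..n. (2 - int (totient (p ^ i))) * 2 ^ (totient (p ^ i) - 1)\<bar>)"
proof -
  define t where "t x = multiplicity (int p) x" for x
  define N where "N = p ^ n - 1"
  define l where "l a = n - 1 - t (vs ! a)" for a
  define q where "q i = int (totient (p ^ Suc i) div 2)" for i
  have set_vs: "set vs = {x. 0 < x \<and> x < int (p ^ n)}"
    using laplacian_eq_level_matrix(2)[OF assms(1,4,5)] .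
  have "set vs = {0<..<int (p ^ n)}"
    unfolding set_vs by (intro equalityI subsetI; simp)
  then have "length vs = nat (int (p ^ n) - 1)"
    using distinct_card[OF assms(4)] by (simp del: of_nat_power)
  moreover have "nat (int m - 1) = m - 1" for m by arith
  ultimately have len: "length vs = N"
    by (simp only: N_def)
  have t_less: "t (vs ! a) < n" if "a < N" for a
  proof -
    have "vs ! a \<in> set vs" using that len by simp
    then show ?thesis
      using multiplicity_less_of_less_prime_power[OF assms(1)] by (simp add: set_vs t_def)
  qed
  have totient: "int (totient (p ^ Suc i)) = 2 * q i" "q i > 0" for i
  proof -
    have "p \<le> p ^ Suc i" using assms(2) by (intro self_le_power) auto
    then have "p ^ Suc i > 2" using assms(2) by linarith
    then have "even (totient (p ^ Suc i))" "totient (p ^ Suc i) > 0"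
      using assms(2) by (auto intro: totient_even)
    then show "int (totient (p ^ Suc i)) = 2 * q i" "q i > 0"
      unfolding q_def by presburger+
  qed
  have card_level: "card {a. a < N \<and> l a = i} = totient (p ^ Suc i)" if "i < n" for i
  proof -
    have "bij_betw ((!) vs) {a. a < N \<and> l a = i} {x. 0 < x \<and> x < int (p ^ n) \<and> t x = n - 1 - i}"
    proof (rule bij_betw_imageI)
      show "inj_on ((!) vs) {a. a < N \<and> l a = i}"
        using len by (intro inj_on_nth assms(4)) simp
      show "(!) vs ` {a. a < N \<and> l a = i} = {x. 0 < x \<and> x < int (p ^ n) \<and> t x = n - 1 - i}"
      proof (intro equalityI subsetI)
        fix x assume "x \<in> (!) vs ` {a. a < N \<and> l a = i}"
        then obtain a where a: "a < N" "l a = i" "x = vs ! a" by auto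
        then have "x \<in> set vs" using len by simp
        then show "x \<in> {x. 0 < x \<and> x < int (p ^ n) \<and> t x = n - 1 - i}"
          using a t_less[of a] that by (auto simp: l_def set_vs)
      next
        fix x assume x: "x \<in> {x. 0 < x \<and> x < int (p ^ n) \<and> t x = n - 1 - i}"
        then have "x \<in> set vs" by (simp add: set_vs)
        then obtain a where "a < N" "x = vs ! a" using len by (auto simp: in_set_conv_nth)
        then show "x \<in> (!) vs ` {a. a < N \<and> l a = i}"
          using x that by (auto simp: l_def)
      qed
    qed
    then have "card {a. a < N \<and> l a = i} = card {x. 0 < x \<and> x < int (p ^ n) \<and> t x = n - 1 - i}"
      by (rule bij_betw_same_card)
    also have "\<dots> = totient (p ^ (n - (n - 1 - i)))"
      unfolding t_def using assms(3) by (intro card_multiplicity_eq assms(1)) simp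
    also have "n - (n - 1 - i) = Suc i" using that by simp
    finally show ?thesis .
  qed
  \<comment> \<open>\<open>p \<ge> 3\<close> makes all fibres even and nonempty, so that each has two representatives.\<close>
  have "\<exists>v w. levels N n l v w q"
    using assms(3) card_level totient by (intro levels_exI) (auto simp: l_def)
  then obtain v w where "levels N n l v w q" by blast
  then interpret levels N n l v w q .
  have "1\<^sub>m N - transpose_mat A = mat N N (\<lambda>(a, b). entry a b)"
    unfolding assms(6) laplacian_eq_level_matrix(1)[OF assms(1,4,5), unfolded len]
    using t_less by (intro cong_mat) (force simp: entry_def l_def t_def)+
  then have minors: "minors (1\<^sub>m (p ^ n - 1) - transpose_mat A) k = minors (mat N N (\<lambda>(a, b). entry a b)) k"
    by (simp add: N_def)
  have "2 * n \<le> N"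
    using card_others by simp
  have "p ^ n > 0"
    using assms(2) by simp
  then have pn: "p ^ n = Suc N"
    by (simp add: N_def)
  show ?thesis
  proof (cases "k = N")
    case True
    have "N = (\<Sum>i<n. totient (p ^ Suc i))"
    proof -
      have "{..<N} = (\<Union>i<n. {a. a < N \<and> l a = i})"
        using level_less by auto
      then have "N = card (\<Union>i<n. {a. a < N \<and> l a = i})"
        by (metis card_lessThan)
      also have "\<dots> = (\<Sum>i<n. totient (p ^ Suc i))"
        by (subst card_UN_disjoint) (auto simp: card_level)
      finally show ?thesis .
    qed
    then have "2 ^ N * (\<Prod>i<n. \<bar>1 - q i\<bar>) = (\<Prod>i<n. \<bar>2 ^ totient (p ^ Suc i) * (1 - q i)\<bar>)"
      by (simp add: power_sum prod.distrib abs_mult)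
    also have "\<dots> = (\<Prod>i<n. \<bar>(2 - int (totient (p ^ Suc i))) * 2 ^ (totient (p ^ Suc i) - 1)\<bar>)"
    proof (intro prod.cong refl arg_cong[of _ _ abs])
      fix i
      obtain m where "totient (p ^ Suc i) = Suc m"
        using totient(1,2)[of i] by (cases "totient (p ^ Suc i)") auto
      then show "2 ^ totient (p ^ Suc i) * (1 - q i)
          = (2 - int (totient (p ^ Suc i))) * 2 ^ (totient (p ^ Suc i) - 1)"
        unfolding totient(1) by simp
    qed
    also have "\<dots> = \<bar>\<Prod>i = 1..n. (2 - int (totient (p ^ i))) * 2 ^ (totient (p ^ i) - 1)\<bar>"
      unfolding abs_prod by (rule prod.reindex_bij_witness[of _ "\<lambda>i. i - 1" Suc]) auto
    finally show ?thesis
      using True \<open>2 * n \<le> N\<close> assms(3) unfolding minors unfolding True Gcd_minors_entry(2)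
      by (auto simp: pn)
  next
    case False
    then have "k < N" using assms(8) by (simp add: N_def)
    consider "k \<le> n" | "n < k" "k \<le> N - n" | "N - n < k" by linarith
    then show ?thesis
    proof cases
      case 1
      then have "k - n + (k - (N - n)) = 0"
        using \<open>2 * n \<le> N\<close> by linarith
      then show ?thesis
        unfolding minors Gcd_minors_entry(1)[OF \<open>k < N\<close>] using 1 assms(7) by simp
    next
      case 2
      then have "k - n + (k - (N - n)) = k - n" by linarith
      then show ?thesis
        unfolding minors Gcd_minors_entry(1)[OF \<open>k < N\<close>] using 2 by (simp add: pn)
    next
      case 3
      then have exponent: "k - n + (k - (N - n)) = 2 * k - p ^ n + 1"
        and range: "\<not> k \<le> n" "\<not> k \<le> p ^ n - n - 1" "p ^ n - n \<le> k" "k \<le> p ^ n - 2"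
        using \<open>2 * n \<le> N\<close> \<open>k < N\<close> unfolding pn by linarith+
      show ?thesis
        unfolding minors Gcd_minors_entry(1)[OF \<open>k < N\<close>] exponent using range by simp
    qed
  qed
qed

end
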